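(* Let $s,n$ be positive integers with $sn$ odd. Let $N$ be a positive integer with $N-1\le N_{s,n}$, and let $j$ be an integer with $0\le j<N$ such that $2j\equiv N_{s,n}\pmod N$. Then $$\sum_{\substack{0\le i\le N_{s,n}\\ i\equiv j\ (\mathrm{mod}\ N)}}t_{i,s,n}=0.$$ In particular, if $N'$ is a positive divisor of $N_{s,n}$, then $$\sum_{0\le \ell\le N_{s,n}/N'}t_{\ell N',s,n}=0.$$
   Context: $N_{s,n}=sn(n+1)/2$, and the integers $t_{i,s,n}$ are defined by $\prod_{k=1}^n(1-q^k)^s=\sum_{i=0}^{N_{s,n}}t_{i,s,n}q^i$. *)

theory Defs
  imports "HOL-Computational_Algebra.Polynomial" "HOL-Number_Theory.Cong"
begin

(* The division is exact, since n * (n + 1) is even. *)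
definition Nsn :: "nat \<Rightarrow> nat \<Rightarrow> nat" where
  "Nsn s n = s * n * (n + 1) div 2"

definition qprod :: "nat \<Rightarrow> nat \<Rightarrow> int poly" where
  "qprod s n = (\<Prod>k=1..n. (1 - monom 1 k) ^ s)"

(* The argument order follows the subscripts in t_{i,s,n}. *)
definition t :: "nat \<Rightarrow> nat \<Rightarrow> nat \<Rightarrow> int" where
  "t i s n = coeff (qprod s n) i"

lemma degree_qprod_le: "degree (qprod s n) \<le> Nsn s n"
proof -
  have d: "degree ((1 - monom 1 k :: int poly) ^ s) \<le> k * s" for k
  proof -
    have "degree (1 - monom 1 k :: int poly) \<le> k"
      by (rule degree_diff_le) (auto simp: degree_monom_eq)
    then show ?thesis
      using degree_power_le[of "1 - monom 1 k :: int poly" s] mult_le_mono1 order_trans by blast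
  qed
  have "degree (qprod s n) \<le> (\<Sum>k=1..n. k * s)"
    unfolding qprod_def
    by (rule order_trans[OF degree_prod_sum_le]) (auto intro!: sum_mono d)
  also have "(\<Sum>k=1..n. k * s) = Nsn s n"
  proof -
    have "2 * (\<Sum>k=1..n. k * s) = s * n * (n + 1)"
      by (induction n) (auto simp: algebra_simps)
    then show ?thesis by (simp add: Nsn_def)
  qed
  finally show ?thesis .
qed

(* The defining expansion of the integers t i s n. *)
lemma qprod_expansion: "qprod s n = (\<Sum>i=0..Nsn s n. monom (t i s n) i)"
  using poly_as_sum_of_monoms'[OF degree_qprod_le[of s n]]
  by (simp add: t_def atLeast0AtMost)

end

(* Each factor 1 - q^k changes sign when its coefficients are reversed, so t_{M-i} = (-1)^{sn} t_i
   with M = N_{s,n}.  For sn odd and 2j = M (mod N), the involution i -> M - i preserves the class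
   of j modulo N and negates the summands. *)
theory Submission
  imports Defs
begin

lemma degree_one_minus_monom: "degree (1 - monom 1 k :: int poly) = k"
proof (cases "k = 0")
  case False
  have "degree (1 - monom 1 k :: int poly) = degree (monom 1 k - 1 :: int poly)"
    by (metis degree_minus minus_diff_eq)
  also have "\<dots> = k"
    using False degree_add_eq_left[of "-1" "monom 1 k :: int poly"] by (simp add: degree_monom_eq)
  finally show ?thesis .
\<comment> \<open>For \<open>k = 0\<close> the polynomial vanishes, and the zero polynomial has
  degree 0 by convention.\<close>
qed (simp add: monom_0 one_pCons)

text \<open>Reversal swaps the only two nonzero coefficients, 1 at index 0 and -1 at index
  \<open>k\<close>.\<close>

lemma reflect_poly_one_minus_monom:
  assumes "k > 0"
  shows "reflect_poly (1 - monom 1 k :: int poly) = - (1 - monom 1 k)"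
  using assms by (intro poly_eqI) (auto simp: coeff_reflect_poly degree_one_minus_monom)

lemma one_minus_monom_nonzero:
  assumes "k > 0"
  shows "(1 - monom 1 k :: int poly) \<noteq> 0"
  using assms degree_one_minus_monom[of k] by force

text \<open>\<open>reflect_poly\<close> reverses about the exact degree, so an upper bound would not
  suffice to identify the reversal with \<open>i\<close> going to
  \<open>Nsn s n - i\<close>.\<close>

lemma degree_qprod: "degree (qprod s n) = Nsn s n"
proof -
  have "degree (qprod s n) = (\<Sum>k=1..n. k * s)"
    unfolding qprod_def
    using one_minus_monom_nonzero
    by (subst degree_prod_eq_sum_degree)
       (auto simp del: right_minus_eq intro!: sum.cong
             simp: degree_power_eq degree_one_minus_monom mult.commute)
  moreover have "2 * (\<Sum>k=1..n. k * s) = s * n * (n + 1)"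
    by (induction n) (auto simp: algebra_simps)
  ultimately show ?thesis by (simp add: Nsn_def)
qed

text \<open>Reversal is multiplicative over the integers, and each of the \<open>n\<close> factors
  contributes the sign \<open>(-1) ^ s\<close>.\<close>

lemma reflect_poly_qprod: "reflect_poly (qprod s n) = (-1) ^ (s * n) * qprod s n"
proof -
  have "reflect_poly (qprod s n) = (\<Prod>k=1..n. (-1) ^ s * (1 - monom 1 k) ^ s)"
    unfolding qprod_def reflect_poly_prod
    by (intro prod.cong refl)
       (simp add: reflect_poly_power reflect_poly_one_minus_monom flip: power_mult_distrib)
  then show ?thesis
    by (simp add: qprod_def prod.distrib power_mult)
qed

lemma t_reflect:
  assumes "odd (s * n)" and "i \<le> Nsn s n"
  shows "t (Nsn s n - i) s n = - t i s n"
proof -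
  have "coeff (reflect_poly (qprod s n)) i = - coeff (qprod s n) i"
    unfolding reflect_poly_qprod power_minus_odd[OF assms(1)] by simp
  then show ?thesis
    using assms(2) by (simp add: coeff_reflect_poly degree_qprod t_def)
qed

lemma cong_reflect:
  fixes i j m N :: nat
  assumes "[2 * j = m] (mod N)" and "i \<le> m" and "[i = j] (mod N)"
  shows "[m - i = j] (mod N)"
proof -
  \<comment> \<open>Adding \<open>i\<close> removes the truncated subtraction, as
    \<open>i \<le> m\<close>; it is cancelled at the end.\<close>
  have "[(m - i) + i = j + j] (mod N)"
    using assms by (simp add: cong_sym mult_2)
  also have "[j + j = j + i] (mod N)"
    using assms(3) by (simp add: cong_add_lcancel_nat cong_sym)
  finally show ?thesis
    by (simp add: cong_add_rcancel_nat)
qed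

lemma sum_t_residue_class:
  assumes "odd (s * n)" and "[2 * j = Nsn s n] (mod N)"
  shows "(\<Sum>i | i \<le> Nsn s n \<and> [i = j] (mod N). t i s n) = 0"
proof -
  let ?A = "{i. i \<le> Nsn s n \<and> [i = j] (mod N)}"
  have "(\<Sum>i\<in>?A. t i s n) = (\<Sum>i\<in>?A. - t i s n)"
    by (rule sum.reindex_bij_witness[where i = "\<lambda>i. Nsn s n - i" and j = "\<lambda>i. Nsn s n - i"])
       (auto simp: t_reflect[OF assms(1)] intro: cong_reflect[OF assms(2)])
  \<comment> \<open>The sum equals its own negative, which forces 0 in the integers.\<close>
  then show ?thesis
    by (simp add: sum_negf)
qed

theorem theorem4p3:
  fixes s n :: nat
  assumes "s > 0" and "n > 0" and "odd (s * n)"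
  shows "(\<forall>N j :: nat. N > 0 \<longrightarrow> N - 1 \<le> Nsn s n \<longrightarrow> j < N \<longrightarrow> [2 * j = Nsn s n] (mod N) \<longrightarrow>
            (\<Sum>i | i \<le> Nsn s n \<and> [i = j] (mod N). t i s n) = 0) \<and>
         (\<forall>N' :: nat. N' > 0 \<longrightarrow> N' dvd Nsn s n \<longrightarrow>
            (\<Sum>l=0..Nsn s n div N'. t (l * N') s n) = 0)"
proof (intro conjI allI impI)
  fix N j :: nat
  assume "[2 * j = Nsn s n] (mod N)"
  then show "(\<Sum>i | i \<le> Nsn s n \<and> [i = j] (mod N). t i s n) = 0"
    by (rule sum_t_residue_class[OF assms(3)])
next
  fix N' :: nat
  assume N': "N' > 0" "N' dvd Nsn s n"
  have "(\<Sum>l=0..Nsn s n div N'. t (l * N') s n) =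
        (\<Sum>i | i \<le> Nsn s n \<and> [i = 0] (mod N'). t i s n)"
    using N'(1)
    \<comment> \<open>The indices \<open>l * N'\<close> run exactly through the residue class of 0
      modulo \<open>N'\<close> up to \<open>Nsn s n\<close>.\<close>
    by (intro sum.reindex_bij_witness[where i = "\<lambda>i. i div N'" and j = "\<lambda>l. l * N'"])
       (auto simp: cong_0_iff less_eq_div_iff_mult_less_eq div_le_mono)
  also have "\<dots> = 0"
    \<comment> \<open>Here \<open>j = 0\<close>: divisibility says that \<open>2 * 0\<close> is
      congruent to \<open>Nsn s n\<close> modulo \<open>N'\<close>.\<close>
    using N'(2) by (intro sum_t_residue_class[OF assms(3)]) (simp add: cong_sym cong_0_iff)
  finally show "(\<Sum>l=0..Nsn s n div N'. t (l * N') s n) = 0" .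
qed

end
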